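(* Let $\mathcal{U}=\mathbb{R}^2\setminus\{(0,0)\}$, let $\mathcal{Z}$ be the set of ellipses in $\mathbb{R}^2$ centred at the origin and of area $\pi$, and let $\mathcal{I}=\{(u,z)\in\mathcal{U}\times\mathcal{Z}: u\in z\}$. The dancing condition on $M=(\mathcal{U}\times\mathcal{Z})\setminus\mathcal{I}$ defines an $SL(2,\mathbb{R})$-invariant sextic $\mathcal{L}(u,z,\dot u,\dot z)=0$ on $TM$ which is quartic in $\dot u$ and quadratic in $\dot z$; that is, a tangent vector $(\dot u,\dot z)\in T_{(u,z)}M$ satisfies the dancing condition if and only if $\mathcal{L}(u,z,\dot u,\dot z)=0$.
   Context: Each ellipse in $\mathcal{Z}$ is given uniquely by an equation $Ex^2+2Fxy+Gy^2=1$ with $EG-F^2=1$, $E>0$, so $\mathcal{Z}$ is a smooth surface (one sheet of a two-sheeted hyperboloid in $\mathbb{R}^3$). The group $SL(2,\mathbb{R})$ acts linearly on $\mathbb{R}^2$, hence on $\mathcal{U}$ and $\mathcal{Z}$, and diagonally on $M$. For $u\in\mathcal{U}$ let $\widehat u=\{z\in\mathcal{Z}: u\in z\}$ be the curve in $\mathcal{Z}$ of ellipses through $u$; for $z\in\mathcal{Z}$ let $\widehat z\subset\mathcal{U}$ be the corresponding ellipse. Dancing condition: a tangent vector $(\dot u,\dot z)\in T_{(u,z)}M$ satisfies the dancing condition if there is an incident pair $(u^*,z^* )\in\mathcal{U}\times\mathcal{Z}$ (i.e. $u^*\in\widehat{z^*}$) such that $\dot u$ is tangent to $\widehat{z^*}$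 at $u$ and $\dot z$ is tangent to $\widehat{u^*}$ at $z$.
   Formalization: The converse (the sextic vanishes, hence the dancing condition holds) is claimed only when the velocity of u is not a multiple of u; for radial velocities it fails, e.g. velocity u with zero velocity of z. That dancing vectors satisfy the sextic is stated for all tangent vectors. *)

theory Defs
  imports "HOL-Analysis.Analysis"
begin

text \<open>The vector (E, F, G) stands for the quadratic form E x^2 + 2 F x y + G y^2, and for the
  conic on which this form takes the value 1.\<close>

definition quad_form :: "real^3 \<Rightarrow> real^2 \<Rightarrow> real" where
  "quad_form z v = z$1 * (v$1)\<^sup>2 + 2 * z$2 * v$1 * v$2 + z$3 * (v$2)\<^sup>2"

definition ellipse :: "real^3 \<Rightarrow> (real^2) set" where
  "ellipse z = {v. quad_form z v = 1}"

definition punctured_plane :: "(real^2) set" where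
  "punctured_plane = - {0}"

text \<open>The surface of ellipses of area \<open>\<pi>\<close> centred at the origin, in the coordinates (E, F, G);
  the lemmas \<open>ellipse_ellipse_space_iff\<close> and \<open>inj_on_ellipse\<close> below justify this
  description.\<close>

definition ellipse_space :: "(real^3) set" where
  "ellipse_space = {z. z$1 > 0 \<and> z$1 * z$3 - (z$2)\<^sup>2 = 1}"

definition ellipses_through :: "real^2 \<Rightarrow> (real^3) set" where
  "ellipses_through u = {z \<in> ellipse_space. u \<in> ellipse z}"

definition nonincident_pairs :: "((real^2) \<times> (real^3)) set" where
  "nonincident_pairs = {(u, z). u \<in> punctured_plane \<and> z \<in> ellipse_space \<and> u \<notin> ellipse z}"

text \<open>Velocity vectors at \<open>p\<close> of differentiable curves in \<open>S\<close>; in particular \<open>p \<in> S\<close>, and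
  the zero vector is tangent to \<open>S\<close> at each of its points.\<close>

definition tangent_at :: "'a::real_normed_vector set \<Rightarrow> 'a \<Rightarrow> 'a \<Rightarrow> bool" where
  "tangent_at S p v \<longleftrightarrow>
     (\<exists>\<gamma> e. e > 0 \<and> \<gamma> 0 = p \<and> (\<forall>t\<in>{-e<..<e}. \<gamma> t \<in> S) \<and>
            (\<gamma> has_vector_derivative v) (at (0::real)))"

definition dancing :: "real^2 \<Rightarrow> real^3 \<Rightarrow> real^2 \<Rightarrow> real^3 \<Rightarrow> bool" where
  "dancing u z u' z' \<longleftrightarrow>
     (\<exists>u\<^sub>0\<in>punctured_plane. \<exists>z\<^sub>0\<in>ellipse_space.
        u\<^sub>0 \<in> ellipse z\<^sub>0 \<and>
        tangent_at (ellipse z\<^sub>0) u u' \<and>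
        tangent_at (ellipses_through u\<^sub>0) z z')"

text \<open>The action of a matrix on forms which corresponds to its linear action on the plane: the
  form \<open>q\<close> is sent to its composition with the inverse of \<open>A\<close>; see \<open>quad_form_form_act\<close>.\<close>

definition sym_matrix :: "real^3 \<Rightarrow> real^2^2" where
  "sym_matrix z = vector [vector [z$1, z$2], vector [z$2, z$3]]"

definition form_act :: "real^2^2 \<Rightarrow> real^3 \<Rightarrow> real^3" where
  "form_act A z =
     (let S = transpose (matrix_inv A) ** sym_matrix z ** matrix_inv A
      in vector [S$1$1, S$1$2, S$2$2])"

text \<open>Forms of bidegree (m, n) in the last two arguments, with coefficients that are polynomial
  functions of the first two.\<close>

definition bihomogeneous_form ::
    "nat \<Rightarrow> nat \<Rightarrow> (real^2 \<Rightarrow> real^3 \<Rightarrow> real^2 \<Rightarrow> real^3 \<Rightarrow> real) \<Rightarrow> bool" where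
  "bihomogeneous_form m n L \<longleftrightarrow>
     real_polynomial_function (\<lambda>(u, z, u', z'). L u z u' z') \<and>
     (\<forall>u z u' z' s t. L u z (s *\<^sub>R u') (t *\<^sub>R z') = s ^ m * t ^ n * L u z u' z')"

lemma quad_form_inner: "quad_form z v = v \<bullet> (sym_matrix z *v v)"
  by (simp add: quad_form_def sym_matrix_def inner_vec_def matrix_vector_mult_def sum_2
      power2_eq_square algebra_simps)

lemma matrix_inv_cancel:
  fixes A :: "real^'n^'n"
  assumes "invertible A"
  shows "A ** matrix_inv A = mat 1" "matrix_inv A ** A = mat 1"
  using someI_ex[of "\<lambda>B. A ** B = mat 1 \<and> B ** A = mat 1"] assms
  unfolding invertible_def matrix_inv_def by blast+

lemma quad_form_form_act:
  assumes "invertible A"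
  shows "quad_form (form_act A z) (A *v v) = quad_form z v"
proof -
  define S where "S = transpose (matrix_inv A) ** sym_matrix z ** matrix_inv A"
  have "S$1$2 = S$2$1"
    by (simp add: S_def sym_matrix_def matrix_matrix_mult_def transpose_def sum_2 algebra_simps)
  then have "sym_matrix (form_act A z) = S"
    unfolding form_act_def S_def[symmetric] Let_def
    by (simp add: sym_matrix_def vec_eq_iff forall_2)
  moreover have "matrix_inv A *v (A *v v) = v"
    using assms by (simp add: matrix_vector_mul_assoc matrix_inv_cancel(2))
  ultimately show ?thesis
    by (metis S_def dot_lmul_matrix matrix_vector_mul_assoc quad_form_inner
        transpose_matrix_vector inner_commute)
qed

lemma ellipse_form_act:
  assumes "invertible A"
  shows "ellipse (form_act A z) = (*v) A ` ellipse z"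
proof -
  have "v \<in> (*v) A ` ellipse z" if "v \<in> ellipse (form_act A z)" for v
  proof -
    have v: "A *v (matrix_inv A *v v) = v"
      using assms by (simp add: matrix_vector_mul_assoc matrix_inv_cancel(1))
    with that have "matrix_inv A *v v \<in> ellipse z"
      using quad_form_form_act[OF assms, of z "matrix_inv A *v v"] by (simp add: ellipse_def)
    with v show ?thesis by (metis imageI)
  qed
  then show ?thesis
    using quad_form_form_act[OF assms] by (auto simp: ellipse_def)
qed

lemma inj_on_ellipse: "inj_on ellipse ellipse_space"
proof (rule inj_onI)
  fix z w :: "real^3"
  assume z: "z \<in> ellipse_space" and w: "w \<in> ellipse_space" and eq: "ellipse z = ellipse w"
  have same: "quad_form w v = quad_form z v" if "quad_form z v > 0" for v
  proof -
    define c where "c = 1 / sqrt (quad_form z v)"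
    have c: "c\<^sup>2 * quad_form z v = 1" "c \<noteq> 0"
      using that by (simp_all add: c_def power_divide)
    have "quad_form x (c *\<^sub>R v) = c\<^sup>2 * quad_form x v" for x
      by (simp add: quad_form_def power2_eq_square algebra_simps)
    with eq c have "c\<^sup>2 * quad_form w v = 1"
      by (metis (mono_tags, lifting) ellipse_def mem_Collect_eq)
    with c show ?thesis by (metis mult_left_cancel power_not_zero)
  qed
  have pos: "z$1 > 0" "z$3 > 0"
    using z by (auto simp: ellipse_space_def)
      (smt (verit) mult_nonneg_nonpos zero_le_power2)
  have 1: "w$1 = z$1"
    using same[of "vector [1, 0]"] pos by (simp add: quad_form_def)
  have 3: "w$3 = z$3"
    using same[of "vector [0, 1]"] pos by (simp add: quad_form_def)
  have "z$1 * quad_form z (vector [1, 1]) = (z$1 + z$2)\<^sup>2 + 1"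
    using z by (simp add: ellipse_space_def quad_form_def power2_eq_square algebra_simps)
  then have "z$1 * quad_form z (vector [1, 1]) > 0"
    by (smt (verit) zero_le_power2)
  then have "quad_form z (vector [1, 1]) > 0"
    using pos by (simp add: zero_less_mult_iff)
  from same[OF this] 1 3 have 2: "w$2 = z$2"
    by (simp add: quad_form_def)
  show "z = w"
    using 1 2 3 by (simp add: vec_eq_iff forall_3)
qed

lemma ellipse_ellipse_space_iff:
  "S \<in> ellipse ` ellipse_space \<longleftrightarrow>
     (\<exists>A::real^2^2. invertible A \<and> S = (*v) A ` sphere 0 1 \<and>
        measure lebesgue ((*v) A ` cball 0 1) = pi)"
proof -
  define I where "I = (vector [1, 0, 1] :: real^3)"
  have I: "ellipse I = sphere 0 1"
    by (auto simp: I_def ellipse_def quad_form_def norm_vec_def L2_set_def sum_2)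
  have area: "measure lebesgue ((*v) A ` cball 0 1) = \<bar>det A\<bar> * pi" for A :: "real^2^2"
  proof -
    have "measure lebesgue (cball (0::real^2) 1) = pi"
      by (simp add: content_cball unit_ball_vol_2)
    then show ?thesis
      using measure_linear_image[of "(*v) A" "cball 0 1"] by simp
  qed
  show ?thesis
  proof
    assume "S \<in> ellipse ` ellipse_space"
    then obtain z where z: "z \<in> ellipse_space" and S: "S = ellipse z" by auto
    have pos: "z$1 > 0" using z by (simp add: ellipse_space_def)
    define r where "r = sqrt (z$1)"
    have r: "r > 0" "r\<^sup>2 = z$1" using pos by (auto simp: r_def)
    define A where "A = (vector [vector [1/r, - z$2 / r], vector [0, r]] :: real^2^2)"
    have det: "det A = 1" using r by (simp add: A_def det_2)
    then have inv: "invertible A" by (simp add: invertible_det_nz)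
    have q: "quad_form z (A *v v) = quad_form I v" for v
    proof -
      have "(A *v v)$1 = (v$1 - z$2 * v$2) / r" "(A *v v)$2 = r * v$2"
        by (simp_all add: A_def matrix_vector_mult_def sum_2 diff_divide_distrib)
      then have "quad_form z (A *v v) = (r\<^sup>2 / r\<^sup>2) * (v$1 - z$2 * v$2)\<^sup>2
          + (r / r) * (2 * z$2 * (v$1 - z$2 * v$2) * v$2) + (z$3 * r\<^sup>2) * (v$2)\<^sup>2"
        by (simp add: quad_form_def r(2)[symmetric] power_divide power_mult_distrib)
      also have "\<dots> = (v$1 - z$2 * v$2)\<^sup>2 + 2 * z$2 * (v$1 - z$2 * v$2) * v$2
          + (1 + (z$2)\<^sup>2) * (v$2)\<^sup>2"
        using r z by (simp add: ellipse_space_def algebra_simps)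
      also have "\<dots> = quad_form I v"
        by (simp add: I_def quad_form_def power2_eq_square algebra_simps)
      finally show ?thesis .
    qed
    have "S = (*v) A ` sphere 0 1"
    proof -
      have "v \<in> (*v) A ` ellipse I" if "v \<in> ellipse z" for v
      proof -
        have v: "A *v (matrix_inv A *v v) = v"
          using inv by (simp add: matrix_vector_mul_assoc matrix_inv_cancel(1))
        with that have "matrix_inv A *v v \<in> ellipse I"
          using q[of "matrix_inv A *v v"] by (simp add: ellipse_def)
        with v show ?thesis by (metis imageI)
      qed
      then show ?thesis using q unfolding S I[symmetric] by (auto simp: ellipse_def)
    qed
    with inv det area show "\<exists>A::real^2^2. invertible A \<and> S = (*v) A ` sphere 0 1 \<and>
        measure lebesgue ((*v) A ` cball 0 1) = pi" by auto
  next
    assume "\<exists>A::real^2^2. invertible A \<and> S = (*v) A ` sphere 0 1 \<and>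
        measure lebesgue ((*v) A ` cball 0 1) = pi"
    then obtain A :: "real^2^2" where inv: "invertible A" and S: "S = (*v) A ` sphere 0 1"
      and d: "\<bar>det A\<bar> = 1" using area by auto
    define B where "B = matrix_inv A"
    have "det A * det B = 1"
      using inv by (metis B_def det_I det_mul matrix_inv_cancel(1))
    with d have dB: "(det B)\<^sup>2 = 1"
      by (metis abs_1 abs_mult mult_1 power2_abs power_one)
    define w where "w = form_act A I"
    have w: "w$1 = (B$1$1)\<^sup>2 + (B$2$1)\<^sup>2" "w$2 = B$1$1 * B$1$2 + B$2$1 * B$2$2"
      "w$3 = (B$1$2)\<^sup>2 + (B$2$2)\<^sup>2"
      by (simp_all add: w_def form_act_def I_def sym_matrix_def B_def[symmetric] Let_def
          matrix_matrix_mult_def transpose_def sum_2 power2_eq_square)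
    have 1: "w$1 * w$3 - (w$2)\<^sup>2 = 1"
      unfolding w using dB by (simp add: det_2 power2_eq_square algebra_simps)
    moreover have "w$1 \<ge> 0" using w by simp
    ultimately have "w$1 > 0"
      by (smt (verit) mult_eq_0_iff zero_le_power2)
    with 1 have "w \<in> ellipse_space" by (simp add: ellipse_space_def)
    moreover have "S = ellipse w"
      unfolding S I[symmetric] w_def ellipse_form_act[OF inv] ..
    ultimately show "S \<in> ellipse ` ellipse_space" by blast
  qed
qed

lemma tangent_at_ellipse_imp:
  assumes "tangent_at (ellipse z) u v"
  shows "z$1 * u$1 * v$1 + z$2 * (u$1 * v$2 + u$2 * v$1) + z$3 * u$2 * v$2 = 0"
proof -
  obtain \<gamma> e where e: "e > 0" and 0: "\<gamma> 0 = u"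
    and S: "\<And>t. t \<in> {-e<..<e} \<Longrightarrow> \<gamma> t \<in> ellipse z"
    and d: "(\<gamma> has_vector_derivative v) (at (0::real))"
    using assms unfolding tangent_at_def by blast
  have comp: "((\<lambda>t. \<gamma> t $ i) has_real_derivative v $ i) (at 0)" for i
    using bounded_linear.has_vector_derivative[OF bounded_linear_vec_nth d, of i]
    by (simp add: has_real_derivative_iff_has_vector_derivative)
  have "((\<lambda>t. quad_form z (\<gamma> t)) has_real_derivative
      2 * (z$1 * u$1 * v$1 + z$2 * (u$1 * v$2 + u$2 * v$1) + z$3 * u$2 * v$2)) (at 0)"
    unfolding quad_form_def
    by (rule derivative_eq_intros comp refl)+ (simp add: 0 algebra_simps)
  moreover have "((\<lambda>t. quad_form z (\<gamma> t)) has_real_derivative 0) (at 0)"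
    by (rule has_field_derivative_transform_within_open[where S = "{-e<..<e}" and f = "\<lambda>_. 1"])
      (use e S in \<open>auto simp: ellipse_def\<close>)
  ultimately show ?thesis
    using DERIV_unique by fastforce
qed

text \<open>A nonzero radial velocity is tangent to no ellipse centred at the origin.\<close>

lemma not_dancing_radial:
  assumes "c \<noteq> 0"
  shows "\<not> dancing u z (c *\<^sub>R u) z'"
proof
  assume "dancing u z (c *\<^sub>R u) z'"
  then obtain w where w: "tangent_at (ellipse w) u (c *\<^sub>R u)"
    unfolding dancing_def by blast
  then have "u \<in> ellipse w"
    unfolding tangent_at_def by force
  then have "quad_form w u = 1" by (simp add: ellipse_def)
  moreover have "c * quad_form w u = 0"
    using tangent_at_ellipse_imp[OF w]
    by (simp add: quad_form_def power2_eq_square algebra_simps)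
  ultimately show False using assms by simp
qed

text \<open>Hence no form of positive degree in the second velocity characterizes the dancing
  condition on all tangent vectors: it vanishes at (u, 0), which does not satisfy the
  condition. The equivalence has to exclude radial u'.\<close>

lemma radial_zero_not_dancing:
  assumes "bihomogeneous_form m n L" "n > 0"
  shows "L u z u 0 = 0 \<and> \<not> dancing u z u 0"
proof
  have "L u z (1 *\<^sub>R u) (0 *\<^sub>R 0) = 1 ^ m * 0 ^ n * L u z u 0"
    using assms unfolding bihomogeneous_form_def by blast
  then show "L u z u 0 = 0" using assms by (simp add: power_0_left)
  show "\<not> dancing u z u 0"
    using not_dancing_radial[of 1 u z 0] by simp
qed

end

theory Submission
  imports Defs
begin

text \<open>Let w be the determinant of (u, u'). If w is nonzero, exactly one ellipse \<open>z\<^sub>0\<close> of area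
  \<open>\<pi>\<close> passes through u with tangent direction u', namely
  \<open>z\<^sub>0(v) = det(u', v)\<^sup>2 / w\<^sup>2 + det(u, v)\<^sup>2\<close>. The dancing condition then asks for a vector
  \<open>u\<^sub>0\<close> with \<open>z\<^sub>0(u\<^sub>0) = z(u\<^sub>0) = 1\<close> and \<open>z'(u\<^sub>0) = 0\<close>, so up to normalization for a common real
  zero of the binary quadratic forms \<open>w\<^sup>2 (z\<^sub>0 - z)\<close>, which is quadratic in u', and z'. The sextic
  is the resultant of these two forms. Since z' is orthogonal to z for the polarized
  discriminant, it is indefinite or zero, and vanishing of the resultant does give a real common
  zero.\<close>

section \<open>Binary quadratic forms, their discriminants and resultant\<close>

definition area_form :: "real^2 \<Rightarrow> real^2 \<Rightarrow> real" where
  "area_form a b = a$1 * b$2 - a$2 * b$1"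

text \<open>The sign is opposite to that of the usual discriminant: a form has a nontrivial real
  zero exactly when \<open>disc\<close> is nonpositive.\<close>

definition disc :: "real^3 \<Rightarrow> real" where
  "disc p = p$1 * p$3 - (p$2)\<^sup>2"

definition disc_polar :: "real^3 \<Rightarrow> real^3 \<Rightarrow> real" where
  "disc_polar p q = p$1 * q$3 + p$3 * q$1 - 2 * p$2 * q$2"

text \<open>This is the discriminant of \<open>disc (p + t *\<^sub>R q)\<close> as a quadratic in t.
  Writing the resultant through invariants makes its own invariance immediate.\<close>

definition quad_resultant :: "real^3 \<Rightarrow> real^3 \<Rightarrow> real" where
  "quad_resultant p q = (disc_polar p q)\<^sup>2 - 4 * disc p * disc q"

definition area_prod :: "real^2 \<Rightarrow> real^2 \<Rightarrow> real^3" where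
  "area_prod m n =
     vector [m$2 * n$2, - (m$1 * n$2 + m$2 * n$1) / 2, m$1 * n$1]"

text \<open>The squared determinant clears the denominator of \<open>tangent_ellipse u u'\<close>,
  so the coefficients are polynomial and defined for radial u' too.\<close>

definition tangency_form :: "real^2 \<Rightarrow> real^3 \<Rightarrow> real^2 \<Rightarrow> real^3" where
  "tangency_form u z u' =
     area_prod u' u' + (area_form u u')\<^sup>2 *\<^sub>R (area_prod u u - z)"

definition dancing_sextic :: "real^2 \<Rightarrow> real^3 \<Rightarrow> real^2 \<Rightarrow> real^3 \<Rightarrow> real" where
  "dancing_sextic u z u' z' = quad_resultant (tangency_form u z u') z'"

lemma vec3_eq_iff: "(p::real^3) = q \<longleftrightarrow> p$1 = q$1 \<and> p$2 = q$2 \<and> p$3 = q$3"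
  by (simp add: vec_eq_iff forall_3)

lemma vec2_eq_iff: "(p::real^2) = q \<longleftrightarrow> p$1 = q$1 \<and> p$2 = q$2"
  by (simp add: vec_eq_iff forall_2)

lemma area_prod_nth [simp]:
  "area_prod m n $ 1 = m$2 * n$2"
  "area_prod m n $ 2 = - (m$1 * n$2 + m$2 * n$1) / 2"
  "area_prod m n $ 3 = m$1 * n$1"
  by (simp_all add: area_prod_def)

lemma quad_form_area_prod: "quad_form (area_prod m n) v = area_form m v * area_form n v"
  by (simp add: quad_form_def area_form_def power2_eq_square field_simps)

lemma quad_form_scaleR: "quad_form z (c *\<^sub>R v) = c\<^sup>2 * quad_form z v"
  by (simp add: quad_form_def power2_eq_square algebra_simps)

lemma quad_form_linear:
  "quad_form (p + q) v = quad_form p v + quad_form q v"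
  "quad_form (p - q) v = quad_form p v - quad_form q v"
  "quad_form (c *\<^sub>R p) v = c * quad_form p v"
  by (simp_all add: quad_form_def algebra_simps)

text \<open>Up to a constant factor, a resultant is the product of the values of one form at the
  zeros of the other, which here are m and n.\<close>

lemma quad_resultant_area_prod:
  "quad_resultant p (k *\<^sub>R area_prod m n) = k\<^sup>2 * quad_form p m * quad_form p n"
  by (simp add: quad_resultant_def disc_polar_def disc_def quad_form_def
      power2_eq_square field_simps)

lemma quad_form_factorization:
  assumes "disc q \<le> 0"
  obtains k m n where "m \<noteq> 0" "n \<noteq> 0" "q = k *\<^sub>R area_prod m n"
proof (cases "q$1 = 0")
  case False
  define d where "d = sqrt (- disc q)"
  have d: "d * d = (q$2)\<^sup>2 - q$1 * q$3"
    using assms by (simp add: d_def disc_def)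
  show ?thesis
  proof
    \<comment> \<open>The two zeros of q from the quadratic formula, with denominators
      cleared.\<close>
    show "vector [d - q$2, q$1] \<noteq> (0::real^2)" "vector [- d - q$2, q$1] \<noteq> (0::real^2)"
      using False by (simp_all add: vec2_eq_iff)
    show "q = (1 / q$1) *\<^sub>R area_prod (vector [d - q$2, q$1]) (vector [- d - q$2, q$1])"
      using False d by (simp add: vec3_eq_iff power2_eq_square field_simps)
  qed
next
  case True
  show ?thesis
  proof (cases "q$2 = 0 \<and> q$3 = 0")
    case zero: True
    show ?thesis
      by (rule that[of "vector [1, 0]" "vector [1, 0]" 0])
        (use True zero in \<open>simp_all add: vec2_eq_iff vec3_eq_iff\<close>)
  next
    case nonzero: False
    show ?thesis
      \<comment> \<open>With no square of the first variable, q is the second variable times a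
        linear form; the vectors are zeros of these two factors.\<close>
      by (rule that[of "vector [1, 0]" "vector [q$3, - 2 * q$2]" 1])
        (use True nonzero in \<open>auto simp: vec2_eq_iff vec3_eq_iff\<close>)
  qed
qed

lemma quad_resultant_eq_0_if_common_zero:
  assumes v: "v \<noteq> 0" and p: "quad_form p v = 0" and q: "quad_form q v = 0"
  shows "quad_resultant p q = 0"
proof -
  have res: "quad_resultant p q = (p$1 * q$3 - p$3 * q$1)\<^sup>2
      - 4 * (p$1 * q$2 - p$2 * q$1) * (p$2 * q$3 - p$3 * q$2)"
    by (simp add: quad_resultant_def disc_polar_def disc_def power2_eq_square algebra_simps)
  \<comment> \<open>Elimination: both products lie in the ideal generated by the values of p and q
    at v.\<close>
  have "(v$1)^4 * quad_resultant p q = 0" "(v$2)^4 * quad_resultant p q = 0"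
    using p q unfolding res quad_form_def by algebra+
  with v show ?thesis by (auto simp: vec2_eq_iff)
qed

text \<open>Once q is split into linear factors, a vanishing resultant makes p vanish at a zero of
  q. If q is the zero form, any zero of p serves, and \<open>disc p \<le> 0\<close> provides
  one.\<close>

lemma common_zero_if_quad_resultant_eq_0:
  assumes p: "disc p \<le> 0" and q: "disc q \<le> 0" and res: "quad_resultant p q = 0"
  obtains v where "v \<noteq> 0" "quad_form p v = 0" "quad_form q v = 0"
proof -
  obtain k m n where mn: "m \<noteq> 0" "n \<noteq> 0" and qk: "q = k *\<^sub>R area_prod m n"
    using q by (rule quad_form_factorization)
  obtain k' m' n' where m': "m' \<noteq> 0" and pk: "p = k' *\<^sub>R area_prod m' n'"
    using p by (rule quad_form_factorization)
  have qmn: "quad_form q m = 0" "quad_form q n = 0"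
    unfolding qk quad_form_linear quad_form_area_prod by (simp_all add: area_form_def)
  have pm': "quad_form p m' = 0"
    unfolding pk quad_form_linear quad_form_area_prod by (simp add: area_form_def)
  from res have "k = 0 \<or> quad_form p m = 0 \<or> quad_form p n = 0"
    unfolding qk quad_resultant_area_prod by simp
  moreover have "quad_form q m' = 0" if "k = 0"
    unfolding qk quad_form_linear using that by simp
  ultimately show ?thesis using that mn m' qmn pm' by blast
qed

section \<open>Ellipses as one sheet of a hyperboloid\<close>

lemma ellipse_spaceI:
  assumes "z$1 \<ge> 0" "disc z = 1"
  shows "z \<in> ellipse_space"
proof -
  have "z$1 \<noteq> 0" using assms(2) by (auto simp: disc_def) (smt (verit) zero_le_power2)
  with assms show ?thesis by (simp add: ellipse_space_def disc_def)
qed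

lemma ellipse_spaceD:
  assumes "z \<in> ellipse_space"
  shows "z$1 > 0" "z$1 * z$3 = 1 + (z$2)\<^sup>2"
  using assms by (auto simp: ellipse_space_def)

lemma quad_form_pos:
  assumes z: "z \<in> ellipse_space" and v: "v \<noteq> 0"
  shows "quad_form z v > 0"
proof -
  note z' = ellipse_spaceD[OF z]
  have eq: "z$1 * quad_form z v = (z$1 * v$1 + z$2 * v$2)\<^sup>2 + (v$2)\<^sup>2"
    using z'(2) unfolding quad_form_def by algebra
  have "z$1 * v$1 + z$2 * v$2 \<noteq> 0 \<or> v$2 \<noteq> 0"
    using v z'(1) by (auto simp: vec2_eq_iff)
  then have "z$1 * quad_form z v > 0"
    unfolding eq by (auto intro: add_pos_nonneg add_nonneg_pos)
  with z'(1) show ?thesis by (simp add: zero_less_mult_iff)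
qed

text \<open>The reversed Cauchy-Schwarz inequality for the Lorentzian form \<open>disc\<close> on
  one sheet of the hyperboloid.\<close>

lemma disc_polar_ge_2:
  assumes z: "z \<in> ellipse_space" and w: "w \<in> ellipse_space"
  shows "disc_polar z w \<ge> 2"
proof -
  note z' = ellipse_spaceD[OF z] and w' = ellipse_spaceD[OF w]
  have "z$1 * w$1 * (disc_polar z w - 2) = (z$1 - w$1)\<^sup>2 + (z$1 * w$2 - w$1 * z$2)\<^sup>2"
    using z'(2) w'(2) unfolding disc_polar_def by algebra
  then have "z$1 * w$1 * (disc_polar z w - 2) \<ge> 0" by simp
  with mult_pos_pos[OF z'(1) w'(1)] show ?thesis
    by (metis diff_ge_0_iff_ge mult_le_cancel_left_pos mult_zero_right)
qed

text \<open>Since \<open>disc\<close> has signature (1, 2) and is positive at z, it is negative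
  definite on the orthogonal complement of z.\<close>

lemma disc_nonpos_if_disc_polar_eq_0:
  assumes z: "z \<in> ellipse_space" and q: "disc_polar z q = 0"
  shows "disc q \<le> 0"
proof -
  note z' = ellipse_spaceD[OF z]
  have "(z$1)\<^sup>2 * disc q = - (z$1 * q$2 - z$2 * q$1)\<^sup>2 - (q$1)\<^sup>2"
    using z'(2) q unfolding disc_polar_def disc_def by algebra
  then have "(z$1)\<^sup>2 * disc q \<le> 0"
    by (smt (verit) zero_le_power2)
  with z'(1) show ?thesis by (simp add: mult_le_0_iff)
qed

section \<open>Linear equations satisfied by tangent vectors\<close>

lemma tangent_at_image:
  assumes t: "tangent_at S p v" and f: "(f has_derivative f') (at p)" and S: "f ` S \<subseteq> T"
  shows "tangent_at T (f p) (f' v)"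
proof -
  obtain \<gamma> e where e: "e > 0" "\<gamma> 0 = p" "\<And>t. t \<in> {-e<..<e} \<Longrightarrow> \<gamma> t \<in> S"
    and d: "(\<gamma> has_vector_derivative v) (at (0::real))"
    using t unfolding tangent_at_def by blast
  have "(f has_derivative f') (at (\<gamma> 0))" using f e by simp
  then have "((f \<circ> \<gamma>) has_vector_derivative f' v) (at 0)"
    by (rule vector_derivative_diff_chain_within[OF d has_derivative_at_withinI])
  then show ?thesis
    unfolding tangent_at_def using e S by (intro exI[of _ "f \<circ> \<gamma>"] exI[of _ e]) auto
qed

text \<open>Together with \<open>tangent_at_image\<close>, this turns an equation f = c on a set
  into a linear equation for its tangent vectors.\<close>

lemma tangent_at_singleton:
  assumes "tangent_at {c} p v"
  shows "v = 0"
proof -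
  obtain \<gamma> e where e: "e > 0" "\<And>t. t \<in> {-e<..<e} \<Longrightarrow> \<gamma> t = c"
    and d: "(\<gamma> has_vector_derivative v) (at (0::real))"
    using assms unfolding tangent_at_def by blast
  have "(\<gamma> has_vector_derivative 0) (at 0)"
    by (rule has_vector_derivative_transform_within_open[where S = "{-e<..<e}" and f = "\<lambda>_. c"])
      (use e in auto)
  with d show ?thesis by (rule vector_derivative_unique_at)
qed

lemma derivative_eq_0_if_tangent_at:
  assumes "tangent_at S p v" "(f has_derivative f') (at p)" "\<And>x. x \<in> S \<Longrightarrow> f x = c"
  shows "f' v = 0"
proof -
  have "tangent_at {c} (f p) (f' v)"
    by (rule tangent_at_image[OF assms(1,2)]) (use assms(3) in auto)
  then show ?thesis by (rule tangent_at_singleton)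
qed

lemma has_derivative_vec_nth [derivative_intros]:
  "(f has_derivative f') F \<Longrightarrow> ((\<lambda>x. f x $ i) has_derivative (\<lambda>h. f' h $ i)) F"
  by (rule bounded_linear.has_derivative[OF bounded_linear_vec_nth])

lemma has_derivative_disc: "(disc has_derivative disc_polar z) (at z)"
  unfolding disc_def disc_polar_def
  by (rule derivative_eq_intros refl)+ (simp add: fun_eq_iff algebra_simps)

lemma tangent_at_mem: "tangent_at S p v \<Longrightarrow> p \<in> S"
  unfolding tangent_at_def by force

lemma tangent_at_ellipse_space_imp:
  assumes "tangent_at ellipse_space z z'"
  shows "disc_polar z z' = 0"
  by (rule derivative_eq_0_if_tangent_at[OF assms has_derivative_disc, where c = 1])
    (simp add: ellipse_space_def disc_def)

lemma tangent_at_nonincident_imp: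
  assumes "tangent_at nonincident_pairs (u, z) (u', z')"
  shows "disc_polar z z' = 0"
proof -
  have "tangent_at ellipse_space (snd (u, z)) (snd (u', z'))"
    by (rule tangent_at_image[OF assms])
      (auto simp: nonincident_pairs_def intro!: derivative_eq_intros)
  then show ?thesis using tangent_at_ellipse_space_imp by simp
qed

lemma tangent_at_ellipses_through_imp:
  assumes "tangent_at (ellipses_through v) z z'"
  shows "quad_form z' v = 0"
proof (rule derivative_eq_0_if_tangent_at[OF assms, where f = "\<lambda>z. quad_form z v" and c = 1])
  show "((\<lambda>z. quad_form z v) has_derivative (\<lambda>z'. quad_form z' v)) (at z)"
    unfolding quad_form_def by (rule derivative_eq_intros refl)+ (simp add: fun_eq_iff)
qed (simp add: ellipses_through_def ellipse_def)

section \<open>Shears and the curve of ellipses through a point\<close>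

definition form_dual :: "real^3 \<Rightarrow> real^2 \<Rightarrow> real^2" where
  "form_dual z v = vector [z$2 * v$1 + z$3 * v$2, - (z$1 * v$1 + z$2 * v$2)]"

text \<open>\<open>area_form (form_dual z v)\<close> is the polar form of z at v, so
  the curve is the orbit of z under the shears along v, that is, the form \<open>z(x + s det(v, x) v)\<close> in the variable x.\<close>

definition shear_curve :: "real^3 \<Rightarrow> real^2 \<Rightarrow> real \<Rightarrow> real^3" where
  "shear_curve z v s =
     z + (2 * s) *\<^sub>R area_prod (form_dual z v) v + (s\<^sup>2 * quad_form z v) *\<^sub>R area_prod v v"

lemma shear_curve_0 [simp]: "shear_curve z v 0 = z"
  by (simp add: shear_curve_def)

lemma quad_form_shear_curve:
  "quad_form (shear_curve z v s) x = quad_form z (x + (s * area_form v x) *\<^sub>R v)"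
  by (simp add: shear_curve_def form_dual_def quad_form_def area_form_def power2_eq_square field_simps)

text \<open>A shear has determinant 1 and so preserves \<open>disc\<close>. The first coefficient of
  a form is its value at (1, 0), nonnegative because z is positive definite.\<close>

lemma shear_curve_in_ellipse_space:
  assumes z: "z \<in> ellipse_space"
  shows "shear_curve z v s \<in> ellipse_space"
proof (rule ellipse_spaceI)
  let ?x = "vector [1, 0] :: real^2"
  have "quad_form z v \<ge> 0" for v
    using quad_form_pos[OF z, of v] by (cases "v = 0") (auto simp: quad_form_def)
  then have "quad_form (shear_curve z v s) ?x \<ge> 0"
    unfolding quad_form_shear_curve .
  then show "shear_curve z v s $ 1 \<ge> 0" by (simp add: quad_form_def)
  show "disc (shear_curve z v s) = 1"
    using ellipse_spaceD(2)[OF z]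
    unfolding disc_def shear_curve_def form_dual_def quad_form_def
    by (simp add: field_simps) algebra
qed

lemma shear_curve_has_vector_derivative:
  "((\<lambda>t. shear_curve z v (c * t)) has_vector_derivative
     (2 * c) *\<^sub>R area_prod (form_dual z v) v) (at 0)"
  unfolding shear_curve_def by (rule derivative_eq_intros refl)+ simp

text \<open>The two linear conditions on q leave a line, spanned by the initial velocity of the
  shear curve along v. Shears along v fix v, so this curve stays among the ellipses through
  v.\<close>

lemma tangent_at_ellipses_throughI:
  assumes z: "z \<in> ellipse_space" and q: "disc_polar z q = 0"
    and v: "quad_form z v = 1" "quad_form q v = 0"
  shows "tangent_at (ellipses_through v) z q"
proof -
  \<comment> \<open>The polar form of z at v has coefficients a and b, so
    \<open>form_dual z v\<close> is (b, -a); c is minus the polar form of q at v and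
    \<open>form_dual z v\<close>.\<close>
  define a where "a = z$1 * v$1 + z$2 * v$2"
  define b where "b = z$2 * v$1 + z$3 * v$2"
  define c where "c = - q$1 * v$1 * b + q$2 * (v$1 * a - v$2 * b) + q$3 * v$2 * a"
  have ab: "a * v$1 + b * v$2 = 1"
    using v(1) unfolding a_def b_def quad_form_def by algebra
  have "z$1 = a\<^sup>2 + (v$2)\<^sup>2" "z$2 = a * b - v$1 * v$2" "z$3 = b\<^sup>2 + (v$1)\<^sup>2"
    using ellipse_spaceD(2)[OF z] v(1) unfolding a_def b_def quad_form_def by algebra+
  \<comment> \<open>The vectors v and \<open>form_dual z v\<close> are z-orthonormal, so
    \<open>disc_polar z q\<close> is the sum of the values of q at both; hence q vanishes at
    \<open>form_dual z v\<close> as well.\<close>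
  with q v(2) have "q$1 * b\<^sup>2 - 2 * q$2 * a * b + q$3 * a\<^sup>2 = 0"
    unfolding disc_polar_def quad_form_def by algebra
  then have "q$1 = - 2 * c * a * v$2" "q$2 = c * (a * v$1 - b * v$2)" "q$3 = 2 * c * b * v$1"
    using ab v(2) unfolding c_def quad_form_def by algebra+
  then have "q = (2 * c) *\<^sub>R area_prod (form_dual z v) v"
    by (simp add: vec3_eq_iff form_dual_def a_def b_def algebra_simps)
  then have "((\<lambda>t. shear_curve z v (c * t)) has_vector_derivative q) (at 0)"
    using shear_curve_has_vector_derivative by simp
  moreover have "shear_curve z v s \<in> ellipses_through v" for s
    using shear_curve_in_ellipse_space[OF z] v(1)
    by (simp add: ellipses_through_def ellipse_def quad_form_shear_curve area_form_def)
  ultimately show ?thesis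
    unfolding tangent_at_def
    by (intro exI[of _ "\<lambda>t. shear_curve z v (c * t)"] exI[of _ 1]) simp
qed

section \<open>The ellipse through u with velocity u'\<close>

definition tangent_ellipse :: "real^2 \<Rightarrow> real^2 \<Rightarrow> real^3" where
  "tangent_ellipse u u' = (1 / (area_form u u')\<^sup>2) *\<^sub>R area_prod u' u' + area_prod u u"

lemma quad_form_tangent_ellipse:
  "quad_form (tangent_ellipse u u') v = (area_form u' v)\<^sup>2 / (area_form u u')\<^sup>2 + (area_form u v)\<^sup>2"
  by (simp add: tangent_ellipse_def quad_form_linear quad_form_area_prod power2_eq_square)

lemma tangent_ellipse_in_ellipse_space:
  assumes "area_form u u' \<noteq> 0"
  shows "tangent_ellipse u u' \<in> ellipse_space"
proof (rule ellipse_spaceI)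
  show "tangent_ellipse u u' $ 1 \<ge> 0" by (simp add: tangent_ellipse_def)
  have "disc (a *\<^sub>R area_prod u' u' + area_prod u u) = a * (area_form u u')\<^sup>2" for a
    by (simp add: disc_def area_form_def power2_eq_square algebra_simps)
  with assms show "disc (tangent_ellipse u u') = 1" by (simp add: tangent_ellipse_def)
qed

lemma tangent_at_tangent_ellipse:
  assumes w: "area_form u u' \<noteq> 0"
  shows "tangent_at (ellipse (tangent_ellipse u u')) u u'"
proof -
  define w where "w = area_form u u'"
  \<comment> \<open>The vectors u and u'/w are orthonormal for \<open>tangent_ellipse u u'\<close>;
    angular speed w gives initial velocity u'.\<close>
  define \<gamma> where "\<gamma> t = cos (w * t) *\<^sub>R u + (sin (w * t) / w) *\<^sub>R u'" for t
  have "area_form u (\<gamma> t) = sin (w * t)" "area_form u' (\<gamma> t) = - w * cos (w * t)" for t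
  proof -
    have "area_form u (\<gamma> t) = sin (w * t) / w * area_form u u'"
      "area_form u' (\<gamma> t) = - cos (w * t) * area_form u u'"
      by (simp_all add: \<gamma>_def area_form_def algebra_simps)
    with w show "area_form u (\<gamma> t) = sin (w * t)" "area_form u' (\<gamma> t) = - w * cos (w * t)"
      by (simp_all add: w_def)
  qed
  then have "\<gamma> t \<in> ellipse (tangent_ellipse u u')" for t
    using w by (simp add: ellipse_def quad_form_tangent_ellipse w_def power_mult_distrib)
  moreover have "(\<gamma> has_vector_derivative u') (at 0)"
    unfolding \<gamma>_def using w by (auto intro!: derivative_eq_intros simp: w_def)
  ultimately show ?thesis
    unfolding tangent_at_def by (intro exI[of _ \<gamma>] exI[of _ 1]) (simp add: \<gamma>_def)
qed

lemma tangency_form_eq: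
  assumes "area_form u u' \<noteq> 0"
  shows "tangency_form u z u' = (area_form u u')\<^sup>2 *\<^sub>R (tangent_ellipse u u' - z)"
  using assms by (simp add: tangency_form_def tangent_ellipse_def scaleR_add_right scaleR_diff_right)

text \<open>Two concentric ellipses of equal area meet: the difference of their forms has
  \<open>disc\<close> equal to 2 minus their \<open>disc_polar\<close>.\<close>

lemma disc_tangency_form_nonpos:
  assumes z: "z \<in> ellipse_space" and w: "area_form u u' \<noteq> 0"
  shows "disc (tangency_form u z u') \<le> 0"
proof -
  note z\<^sub>0 = tangent_ellipse_in_ellipse_space[OF w]
  have disc: "disc (c *\<^sub>R (p - q)) = c\<^sup>2 * (disc p + disc q - disc_polar p q)" for c p q
    by (simp add: disc_def disc_polar_def power2_eq_square algebra_simps)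
  show ?thesis
    unfolding tangency_form_eq[OF w] disc
    using z z\<^sub>0 disc_polar_ge_2[OF z\<^sub>0 z] by (simp add: ellipse_space_def disc_def mult_le_0_iff)
qed

section \<open>The dancing condition and the zeros of the sextic\<close>

lemma dancing_if_sextic_eq_0:
  assumes z: "z \<in> ellipse_space" and z': "disc_polar z z' = 0"
    and w: "area_form u u' \<noteq> 0" and L: "dancing_sextic u z u' z' = 0"
  shows "dancing u z u' z'"
proof -
  obtain v where v: "v \<noteq> 0" "quad_form (tangency_form u z u') v = 0" "quad_form z' v = 0"
    using common_zero_if_quad_resultant_eq_0[OF disc_tangency_form_nonpos[OF z w]
        disc_nonpos_if_disc_polar_eq_0[OF z z']] L unfolding dancing_sextic_def by blast
  have pos: "quad_form z v > 0" using quad_form_pos[OF z v(1)] .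
  define u\<^sub>0 where "u\<^sub>0 = (1 / sqrt (quad_form z v)) *\<^sub>R v"
  \<comment> \<open>Both forms take the same positive value at v, so a single rescaling puts the
    point on both ellipses.\<close>
  have "quad_form (tangent_ellipse u u') v = quad_form z v"
    using v(2) w unfolding tangency_form_eq[OF w] quad_form_linear by simp
  then have u\<^sub>0: "quad_form (tangent_ellipse u u') u\<^sub>0 = 1" "quad_form z u\<^sub>0 = 1" "quad_form z' u\<^sub>0 = 0"
    using pos v(3) by (simp_all add: u\<^sub>0_def quad_form_scaleR power_divide)
  moreover have "u\<^sub>0 \<in> punctured_plane"
    using v(1) pos by (simp add: u\<^sub>0_def punctured_plane_def)
  ultimately show ?thesis
    unfolding dancing_def
    using tangent_ellipse_in_ellipse_space[OF w] tangent_at_tangent_ellipse[OF w]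
      tangent_at_ellipses_throughI[OF z z' u\<^sub>0(2,3)]
    by (intro bexI[of _ u\<^sub>0] bexI[of _ "tangent_ellipse u u'"]) (simp_all add: ellipse_def)
qed

text \<open>The point \<open>u\<^sub>0\<close> of the incident pair is itself the common zero.
  Nothing is divided by the determinant of u and u', so that determinant may vanish.\<close>

lemma sextic_eq_0_if_dancing:
  assumes "dancing u z u' z'"
  shows "dancing_sextic u z u' z' = 0"
proof -
  obtain u\<^sub>0 z\<^sub>0 where u\<^sub>0: "u\<^sub>0 \<in> punctured_plane" and z\<^sub>0: "z\<^sub>0 \<in> ellipse_space" "u\<^sub>0 \<in> ellipse z\<^sub>0"
    and tu: "tangent_at (ellipse z\<^sub>0) u u'" and tz: "tangent_at (ellipses_through u\<^sub>0) z z'"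
    using assms unfolding dancing_def by blast
  have u: "quad_form z\<^sub>0 u = 1" using tangent_at_mem[OF tu] by (simp add: ellipse_def)
  have 0: "quad_form z\<^sub>0 u\<^sub>0 = 1" using z\<^sub>0 by (simp add: ellipse_def)
  have 1: "quad_form z u\<^sub>0 = 1"
    using tangent_at_mem[OF tz] by (simp add: ellipses_through_def ellipse_def)
  \<comment> \<open>Lagrange's identity for a form with \<open>disc\<close> 1, using that its value
    at u is 1.\<close>
  have polar: "quad_form z\<^sub>0 v = (z\<^sub>0$1 * u$1 * v$1 + z\<^sub>0$2 * (u$1 * v$2 + u$2 * v$1) + z\<^sub>0$3 * u$2 * v$2)\<^sup>2
      + (area_form u v)\<^sup>2" for v
    using u ellipse_spaceD(2)[OF z\<^sub>0(1)] unfolding quad_form_def area_form_def by algebra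
  \<comment> \<open>Tangency means that u and u' are orthogonal for \<open>z\<^sub>0\<close>; both
    sides are linear in \<open>u\<^sub>0\<close> and agree at u and at u'.\<close>
  have "area_form u u' * (z\<^sub>0$1 * u$1 * u\<^sub>0$1 + z\<^sub>0$2 * (u$1 * u\<^sub>0$2 + u$2 * u\<^sub>0$1) + z\<^sub>0$3 * u$2 * u\<^sub>0$2)
      = - area_form u' u\<^sub>0"
    using tangent_at_ellipse_imp[OF tu] u unfolding area_form_def quad_form_def by algebra
  with polar[of u\<^sub>0] 0 have "(area_form u' u\<^sub>0)\<^sup>2 + (area_form u u')\<^sup>2 * (area_form u u\<^sub>0)\<^sup>2
      = (area_form u u')\<^sup>2"
    by algebra
  then have "quad_form (tangency_form u z u') u\<^sub>0 = 0"
    unfolding tangency_form_def quad_form_linear quad_form_area_prod 1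
    by (simp add: power2_eq_square algebra_simps)
  then show ?thesis
    unfolding dancing_sextic_def
    using u\<^sub>0 tangent_at_ellipses_through_imp[OF tz]
    by (intro quad_resultant_eq_0_if_common_zero[of u\<^sub>0]) (simp_all add: punctured_plane_def)
qed

lemma area_form_nonzero:
  assumes "u \<noteq> 0" "u' \<notin> span {u}"
  shows "area_form u u' \<noteq> 0"
proof
  assume w: "area_form u u' = 0"
  define c where "c = (u$1 * u'$1 + u$2 * u'$2) / ((u$1)\<^sup>2 + (u$2)\<^sup>2)"
  have "(u$1)\<^sup>2 + (u$2)\<^sup>2 \<noteq> 0"
    using assms(1) by (simp add: vec2_eq_iff sum_power2_eq_zero_iff)
  then have "u' = c *\<^sub>R u"
    using w unfolding vec2_eq_iff c_def
    by (simp add: field_simps area_form_def power2_eq_square)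
  then have "u' \<in> span {u}" by (simp add: span_base span_scale)
  with assms(2) show False by simp
qed

section \<open>Invariance under SL(2)\<close>

lemma matrix_inv_det_1:
  fixes A :: "real^2^2"
  assumes "det A = 1"
  shows "matrix_inv A = vector [vector [A$2$2, - A$1$2], vector [- A$2$1, A$1$1]]" (is "_ = ?B")
proof -
  have inv: "invertible A" using assms by (simp add: invertible_det_nz)
  have "A ** ?B = mat 1"
    using assms by (simp add: vec_eq_iff forall_2 matrix_matrix_mult_def sum_2 mat_def det_2 algebra_simps)
  then have "matrix_inv A ** (A ** ?B) = matrix_inv A" by simp
  then show ?thesis
    by (simp add: matrix_mul_assoc matrix_inv_cancel(2)[OF inv])
qed

lemma form_act_nth:
  fixes A :: "real^2^2"
  assumes "det A = 1"
  shows "form_act A z $ 1 = z$1 * (A$2$2)\<^sup>2 - 2 * z$2 * A$2$2 * A$2$1 + z$3 * (A$2$1)\<^sup>2"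
    "form_act A z $ 2 = - z$1 * A$2$2 * A$1$2
      + z$2 * (A$1$1 * A$2$2 + A$1$2 * A$2$1) - z$3 * A$2$1 * A$1$1"
    "form_act A z $ 3 = z$1 * (A$1$2)\<^sup>2 - 2 * z$2 * A$1$2 * A$1$1 + z$3 * (A$1$1)\<^sup>2"
  unfolding form_act_def matrix_inv_det_1[OF assms]
  by (simp_all add: Let_def sym_matrix_def matrix_matrix_mult_def transpose_def sum_2
      power2_eq_square algebra_simps)

lemma form_act_linear:
  fixes A :: "real^2^2"
  assumes "det A = 1"
  shows "form_act A (p + q) = form_act A p + form_act A q"
    "form_act A (p - q) = form_act A p - form_act A q"
    "form_act A (c *\<^sub>R p) = c *\<^sub>R form_act A p"
  by (simp_all add: vec3_eq_iff form_act_nth[OF assms] algebra_simps)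

lemma area_form_act:
  fixes A :: "real^2^2"
  shows "area_form (A *v a) (A *v b) = det A * area_form a b"
  by (simp add: area_form_def det_2 matrix_vector_mult_def sum_2 algebra_simps)

lemma form_act_area_prod:
  fixes A :: "real^2^2"
  assumes "det A = 1"
  shows "form_act A (area_prod m n) = area_prod (A *v m) (A *v n)"
  by (simp add: vec3_eq_iff form_act_nth[OF assms] matrix_vector_mult_def sum_2
      power2_eq_square field_simps)

lemma disc_polar_form_act:
  fixes A :: "real^2^2"
  assumes "det A = 1"
  shows "disc_polar (form_act A p) (form_act A q) = disc_polar p q"
  using assms unfolding disc_polar_def form_act_nth[OF assms] det_2 by algebra

lemma disc_eq_disc_polar: "disc p = disc_polar p p / 2"
  by (simp add: disc_def disc_polar_def power2_eq_square)

text \<open>The tangency form is equivariant, and the resultant is built from the invariant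
  \<open>disc_polar\<close>.\<close>

lemma dancing_sextic_invariant:
  fixes A :: "real^2^2"
  assumes "det A = 1"
  shows "dancing_sextic (A *v u) (form_act A z) (A *v u') (form_act A z') =
    dancing_sextic u z u' z'"
proof -
  have "tangency_form (A *v u) (form_act A z) (A *v u') = form_act A (tangency_form u z u')"
    by (simp add: tangency_form_def form_act_linear form_act_area_prod area_form_act assms)
  then show ?thesis
    by (simp add: dancing_sextic_def quad_resultant_def disc_eq_disc_polar disc_polar_form_act assms)
qed

section \<open>Bidegree and nontriviality of the sextic\<close>

lemma real_polynomial_function_component:
  assumes "bounded_linear f"
  shows "real_polynomial_function (\<lambda>x. f x $ i)"
  by (intro real_polynomial_function.intros(1) bounded_linear_compose[OF bounded_linear_vec_nth] assms)

text \<open>The resultant is quadratic in each form, and the tangency form is quadratic in u', which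
  gives degrees 4 and 2.\<close>

lemma bihomogeneous_dancing_sextic: "bihomogeneous_form 4 2 dancing_sextic"
proof -
  have "dancing_sextic u z (s *\<^sub>R u') (t *\<^sub>R z') = s ^ 4 * t\<^sup>2 * dancing_sextic u z u' z'"
    for u z u' z' s t
  proof -
    have "tangency_form u z (s *\<^sub>R u') = s\<^sup>2 *\<^sub>R tangency_form u z u'"
      by (simp add: tangency_form_def vec3_eq_iff area_form_def power2_eq_square field_simps)
    moreover have "quad_resultant (a *\<^sub>R p) (b *\<^sub>R q) = a\<^sup>2 * b\<^sup>2 * quad_resultant p q" for a b p q
      by (simp add: quad_resultant_def disc_polar_def disc_def power2_eq_square algebra_simps)
    ultimately show ?thesis by (simp add: dancing_sextic_def)
  qed
  moreover have "real_polynomial_function (\<lambda>(u, z, u', z'). dancing_sextic u z u' z')"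
    unfolding case_prod_beta dancing_sextic_def quad_resultant_def disc_polar_def disc_def
      tangency_form_def area_form_def vector_add_component vector_minus_component
      vector_scaleR_component area_prod_nth real_scaleR_def divide_inverse
    by (intro real_polynomial_function.intros(2-) real_polynomial_function_diff
        real_polynomial_function_minus real_polynomial_function_power
        real_polynomial_function_component bounded_linear_fst bounded_linear_snd
        bounded_linear_compose[OF bounded_linear_fst] bounded_linear_compose[OF bounded_linear_snd])
  ultimately show ?thesis unfolding bihomogeneous_form_def by simp
qed

text \<open>A radial u' makes the tangency form the square of \<open>det(u', \<cdot>)\<close>, so that the sextic becomes
  \<open>z'(u)\<^sup>2\<close>. The direction of the shear is u plus its z-orthogonal vector, so that z' does not
  vanish at u.\<close>

lemma dancing_sextic_nontrivial:
  assumes "(u, z) \<in> nonincident_pairs"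
  shows "\<exists>u' z'. tangent_at nonincident_pairs (u, z) (u', z') \<and> dancing_sextic u z u' z' \<noteq> 0"
proof -
  have u: "u \<noteq> 0" and z: "z \<in> ellipse_space" and nz: "quad_form z u \<noteq> 1"
    using assms by (auto simp: nonincident_pairs_def punctured_plane_def ellipse_def)
  define v where "v = u + form_dual z u"
  define z' where "z' = 2 *\<^sub>R area_prod (form_dual z v) v"
  define \<gamma> where "\<gamma> t = ((1 + t) *\<^sub>R u, shear_curve z v t)" for t
  have d: "(\<gamma> has_vector_derivative (u, z')) (at 0)"
    unfolding \<gamma>_def z'_def
    using shear_curve_has_vector_derivative[of z v 1]
    by (intro has_vector_derivative_Pair) (auto intro!: derivative_eq_intros)
  define f where "f t = quad_form (shear_curve z v t) ((1 + t) *\<^sub>R u)" for t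
  have "isCont f 0"
    unfolding f_def quad_form_def shear_curve_def by (intro continuous_intros)
  moreover have "f 0 \<noteq> 1" using nz by (simp add: f_def)
  ultimately obtain e where e: "e > 0" "\<And>t. \<bar>t\<bar> < e \<Longrightarrow> f t \<noteq> 1"
    using continuous_at_avoid[of 0 f 1] by (auto simp: dist_real_def)
  \<comment> \<open>The bound e keeps the point off the moving ellipse; the bound 1 keeps 1 + t
    nonzero and so the point away from the origin.\<close>
  have "\<gamma> t \<in> nonincident_pairs" if "t \<in> {- min e 1<..<min e 1}" for t
  proof -
    have "\<bar>t\<bar> < e" "1 + t \<noteq> 0" using that by auto
    then show ?thesis
      using e(2)[of t] u shear_curve_in_ellipse_space[OF z]
      by (simp add: nonincident_pairs_def \<gamma>_def f_def punctured_plane_def ellipse_def)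
  qed
  with d e(1) have "tangent_at nonincident_pairs (u, z) (u, z')"
    unfolding tangent_at_def by (intro exI[of _ \<gamma>] exI[of _ "min e 1"]) (simp add: \<gamma>_def)
  moreover have "dancing_sextic u z u z' = (quad_form z' u)\<^sup>2"
    by (simp add: dancing_sextic_def tangency_form_def quad_resultant_def disc_polar_def disc_def
        quad_form_def area_form_def power2_eq_square algebra_simps)
  moreover have "quad_form z' u = 2 * (quad_form z u)\<^sup>2"
  proof -
    \<comment> \<open>The vector \<open>form_dual z u\<close> is z-orthogonal to u, and its
      determinant with u is \<open>quad_form z u\<close>.\<close>
    have "area_form (form_dual z v) u = quad_form z u" "area_form v u = quad_form z u"
      by (simp_all add: v_def form_dual_def quad_form_def area_form_def power2_eq_square algebra_simps)
    then show ?thesis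
      by (simp add: z'_def quad_form_linear quad_form_area_prod power2_eq_square)
  qed
  moreover have "quad_form z u \<noteq> 0" using quad_form_pos[OF z u] by simp
  ultimately show ?thesis by (intro exI[of _ u] exI[of _ z']) simp
qed

theorem theorem2p4:
  "\<exists>L :: real^2 \<Rightarrow> real^3 \<Rightarrow> real^2 \<Rightarrow> real^3 \<Rightarrow> real.
     bihomogeneous_form 4 2 L \<and>
     (\<forall>(u, z) \<in> nonincident_pairs.
        \<exists>u' z'. tangent_at nonincident_pairs (u, z) (u', z') \<and> L u z u' z' \<noteq> 0) \<and>
     (\<forall>(u, z) \<in> nonincident_pairs. \<forall>u' z'. \<forall>A :: real^2^2.
        tangent_at nonincident_pairs (u, z) (u', z') \<and> det A = 1 \<longrightarrow>
          L (A *v u) (form_act A z) (A *v u') (form_act A z') = L u z u' z') \<and>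
     (\<forall>(u, z) \<in> nonincident_pairs. \<forall>u' z'.
        tangent_at nonincident_pairs (u, z) (u', z') \<longrightarrow>
          (dancing u z u' z' \<longrightarrow> L u z u' z' = 0) \<and>
          (u' \<notin> span {u} \<longrightarrow> (dancing u z u' z' \<longleftrightarrow> L u z u' z' = 0)))"
proof -
  \<comment> \<open>Nonradial u' gives a nonzero determinant, and tangency to M makes z' orthogonal
    to z.\<close>
  have "dancing u z u' z'"
    if "(u, z) \<in> nonincident_pairs" "tangent_at nonincident_pairs (u, z) (u', z')"
      "u' \<notin> span {u}" "dancing_sextic u z u' z' = 0" for u z u' z'
    using that tangent_at_nonincident_imp[OF that(2)]
    by (intro dancing_if_sextic_eq_0 area_form_nonzero)
      (auto simp: nonincident_pairs_def punctured_plane_def)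
  then show ?thesis
    using bihomogeneous_dancing_sextic dancing_sextic_nontrivial dancing_sextic_invariant
      sextic_eq_0_if_dancing
    by (intro exI[of _ dancing_sextic]) auto
qed

end
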